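(* Let $\tau$ be a $\Phi$-tope. For any $\lambda\in F$, the function $\mathcal X(\Phi,\tau)\,[V(\Phi,\lambda)]$ on $\mathbb R^N$ is a signed sum of (characteristic functions of) bounded, possibly semi-open, polytopes. In particular, its support is bounded.
   Context: $F$ is a real vector space of dimension $r$; $\Phi=(\phi_1,\dots,\phi_N)$ is a sequence of nonzero elements of $F$ which generates $F$ and such that the cone $\mathfrak c(\Phi)=\{\sum_i t_i\phi_i:t_i\ge 0\}$ is salient (contains no affine line). $V(\Phi,\lambda)=\{x\in\mathbb R^N:\sum_i x_i\phi_i=\lambda\}$. $[E]$ is the characteristic function of $E\subseteq\mathbb R^N$. A $\Phi$-wall is a hyperplane of $F$ spanned by $r-1$ linearly independent elements of $\Phi$; a $\Phi$-tope is a connected component of the complement in $F$ of the union of all $\Phi$-walls. $\mathcal G(\Phi,\tau)$ is the set of $I\subseteq\{1,\dots,N\}$ such that $\{\phi_i,i\in I\}$ generates $F$ and $\tau$ is contained in the cone generated by $\{\phi_i,i\in I\}$. With $I^c$ the complement of $I$, $\mathcal X(\Phi,\tau)=\sum_{I\in\mathcal G(\Phi,\tau)}(-1)^{|I|-\dim F}\prod_{j\in I^c}[x_j\ge 0]$. A possibly semi-open polytope is a bounded set defined by finitely many affine equations and weak or strict affine inequalities; a signed sum means a finite linear combination with integer coefficients. *)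

theory Defs
  imports "HOL-Analysis.Analysis"
begin

definition gen_cone :: "('n \<Rightarrow> 'a::real_vector) \<Rightarrow> 'n set \<Rightarrow> 'a set" where
  "gen_cone \<Phi> I = {\<Sum>i\<in>I. t i *\<^sub>R \<Phi> i | t. \<forall>i\<in>I. 0 \<le> t i}"

definition salient :: "'a::euclidean_space set \<Rightarrow> bool" where
  "salient C \<longleftrightarrow> (\<nexists>L. affine L \<and> aff_dim L = 1 \<and> L \<subseteq> C)"

definition walls :: "('n \<Rightarrow> 'a::euclidean_space) \<Rightarrow> 'a set set" where
  "walls \<Phi> = {span S | S. S \<subseteq> range \<Phi> \<and> independent S \<and> card S = DIM('a) - 1}"

definition topes :: "('n \<Rightarrow> 'a::euclidean_space) \<Rightarrow> 'a set set" where
  "topes \<Phi> = components (- \<Union> (walls \<Phi>))"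

definition part_space :: "('n::finite \<Rightarrow> 'a::real_vector) \<Rightarrow> 'a \<Rightarrow> (real ^ 'n) set" where
  "part_space \<Phi> v = {x. (\<Sum>i\<in>UNIV. x $ i *\<^sub>R \<Phi> i) = v}"

definition gen_sets :: "('n \<Rightarrow> 'a::real_vector) \<Rightarrow> 'a set \<Rightarrow> 'n set set" where
  "gen_sets \<Phi> \<tau> = {I. span (\<Phi> ` I) = UNIV \<and> \<tau> \<subseteq> gen_cone \<Phi> I}"

text \<open>The truncated subtraction in the exponent is harmless: a generating family
  has at least as many members as the dimension of the space.\<close>

definition geom_fun :: "('n::finite \<Rightarrow> 'a::euclidean_space) \<Rightarrow> 'a set \<Rightarrow> real ^ 'n \<Rightarrow> int" where
  "geom_fun \<Phi> \<tau> x =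
     (\<Sum>I\<in>gen_sets \<Phi> \<tau>. (-1) ^ (card I - DIM('a)) * (\<Prod>j\<in>- I. indicator {y. 0 \<le> y $ j} x))"

text \<open>A pair \<open>(a, b)\<close> encodes the affine function \<open>\<lambda>x. a \<bullet> x - b\<close>; the finite sets
  \<open>E\<close>, \<open>W\<close>, \<open>S\<close> collect the equations, the weak and the strict inequalities.\<close>

definition semi_open_polytope :: "'b::euclidean_space set \<Rightarrow> bool" where
  "semi_open_polytope P \<longleftrightarrow> bounded P \<and>
     (\<exists>E W S. finite E \<and> finite W \<and> finite S \<and>
        P = {x. (\<forall>(a, b)\<in>E. a \<bullet> x = b) \<and> (\<forall>(a, b)\<in>W. a \<bullet> x \<le> b) \<and> (\<forall>(a, b)\<in>S. a \<bullet> x < b)})"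

definition signed_sum_of_polytopes :: "('b::euclidean_space \<Rightarrow> int) \<Rightarrow> bool" where
  "signed_sum_of_polytopes f \<longleftrightarrow>
     (\<exists>\<P> c. finite \<P> \<and> (\<forall>P\<in>\<P>. semi_open_polytope P) \<and>
        f = (\<lambda>x. \<Sum>P\<in>\<P>. c P * indicator P x))"

end

theory Submission
  imports Defs
begin

text \<open>
  The value of \<open>geom_fun \<Phi> \<tau>\<close> at \<open>x\<close> depends only on the set \<open>N\<close> of coordinates at which \<open>x\<close> is
  negative: it is the integer \<open>orthant_coeff \<Phi> \<tau> N\<close>. Hence the function in question is the
  combination, with these coefficients, of the indicators of the pieces \<open>fibre_piece \<Phi> v N\<close> into
  which the half-open orthants cut the fibre of \<open>v\<close>. Each piece is given by finitely
  many equations and inequalities, so everything reduces to one claim: if the coefficient of \<open>N\<close>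
  is not zero, then the piece of \<open>N\<close> is bounded.

  A piece that is not bounded yields, by compactness of the unit sphere, a relation
  \<open>\<Sum>\<^sub>i z\<^sub>i \<Phi>\<^sub>i = 0\<close> with \<open>z \<noteq> 0\<close>, \<open>z \<le> 0\<close> on \<open>N\<close> and \<open>z \<ge> 0\<close> off \<open>N\<close>. Since the cone is salient
  the relation cannot live on \<open>N\<close> alone, so \<open>z\<^sub>a > 0\<close> for some \<open>a \<notin> N\<close>; read differently,
  some nonnegative combination of the \<open>\<Phi>\<^sub>i\<close>, \<open>i \<notin> N\<close>, with \<open>\<Phi>\<^sub>a\<close> really present,
  lies in the cone generated by the \<open>\<Phi>\<^sub>i\<close>, \<open>i \<in> N\<close>.

  On the other side, the tope meets no wall, and the boundary of each cone generated by a subfamily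
  is covered by walls. So a single point \<open>p\<close> of the tope decides whether the tope lies
  in the cone of \<open>I\<close>, and up to a global sign the coefficient of \<open>N\<close> is
  \<open>\<Sum>\<^sub>S (-1)\<^bsup>|S|\<^esup> [p \<in> cone (N \<union> S)]\<close>, the sum being over the subsets \<open>S\<close> of the
  complement of \<open>N\<close>. That this vanishes is a statement about convex cones alone
  (\<open>alternating_cone_sum_eq_0\<close>). It is proved by induction on the number of vectors, using that
  for a convex cone \<open>C\<close> and a vector \<open>p\<close> the cones \<open>C + \<real>\<^sub>\<ge>\<^sub>0 p\<close> and \<open>C - \<real>\<^sub>\<ge>\<^sub>0 p\<close> have union
  \<open>C + \<real> p\<close> and intersection \<open>C\<close>.
\<close>

section \<open>Alternating sums of convex cones\<close>

lemma convex_cone_hull_insert: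
  "convex_cone hull (insert p Y) = {y + s *\<^sub>R p | y s. y \<in> convex_cone hull Y \<and> 0 \<le> s}"
proof -
  have "convex_cone hull {p} = {s *\<^sub>R p | s. 0 \<le> s}"
    by (force simp: convex_cone_hull_convex_hull_nonempty)
  then show ?thesis
    using convex_cone_hull_Un[of Y "{p}"] by auto
qed

text \<open>The two half-line extensions of a convex cone \<open>C\<close> cover \<open>C + \<real> p\<close>. They meet in \<open>C\<close>, because
  a point \<open>c + s p = c' - t p\<close> is the mean of \<open>c\<close> and \<open>c'\<close> with weights \<open>t\<close> and \<open>s\<close>, or \<open>c\<close> itself
  when \<open>s = t = 0\<close>.\<close>

lemma cone_line_valuation:
  "of_bool (q \<in> convex_cone hull Y) + of_bool (q \<in> convex_cone hull (insert p (insert (- p) Y)))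
   = (of_bool (q \<in> convex_cone hull (insert p Y))
      + of_bool (q \<in> convex_cone hull (insert (- p) Y)) :: int)"
proof -
  let ?C = "convex_cone hull Y"
  let ?P = "convex_cone hull (insert p Y)" and ?M = "convex_cone hull (insert (- p) Y)"
  let ?L = "convex_cone hull (insert p (insert (- p) Y))"
  have sub: "?C \<subseteq> ?P" "?C \<subseteq> ?M" "?P \<subseteq> ?L" "?M \<subseteq> ?L"
    by (auto intro!: hull_mono)
  have cover: "q \<in> ?P \<or> q \<in> ?M" if L: "q \<in> ?L"
  proof -
    obtain c s t where q: "q = c + t *\<^sub>R (- p) + s *\<^sub>R p" "c \<in> ?C" "0 \<le> s" "0 \<le> t"
      using L by (auto simp: convex_cone_hull_insert)
    show ?thesis
    proof (cases "t \<le> s")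
      case True
      have "q = c + (s - t) *\<^sub>R p"
        using q by (simp add: algebra_simps)
      with True q(2) have "q \<in> ?P"
        unfolding convex_cone_hull_insert by (auto intro!: exI[of _ c] exI[of _ "s - t"])
      then show ?thesis ..
    next
      case False
      have "q = c + (t - s) *\<^sub>R (- p)"
        using q by (simp add: algebra_simps)
      with False q(2) have "q \<in> ?M"
        unfolding convex_cone_hull_insert by (auto intro!: exI[of _ c] exI[of _ "t - s"])
      then show ?thesis ..
    qed
  qed
  have meet: "q \<in> ?C" if P: "q \<in> ?P" and M: "q \<in> ?M"
  proof -
    obtain c s where c: "q = c + s *\<^sub>R p" "c \<in> ?C" "0 \<le> s"
      using P by (auto simp: convex_cone_hull_insert)
    obtain c' t where c': "q = c' + t *\<^sub>R (- p)" "c' \<in> ?C" "0 \<le> t"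
      using M by (auto simp: convex_cone_hull_insert)
    show ?thesis
    proof (cases "s + t = 0")
      case True
      then have "s = 0"
        using c c' by linarith
      with c show ?thesis by simp
    next
      case False
      then have pos: "s + t > 0"
        using c c' by simp
      have "(s + t) *\<^sub>R q = t *\<^sub>R q + s *\<^sub>R q"
        by (simp add: algebra_simps)
      also have "\<dots> = t *\<^sub>R (c + s *\<^sub>R p) + s *\<^sub>R (c' + t *\<^sub>R (- p))"
        using c(1) c'(1) by simp
      also have "\<dots> = t *\<^sub>R c + s *\<^sub>R c'"
        by (simp add: algebra_simps)
      finally have "(s + t) *\<^sub>R q = t *\<^sub>R c + s *\<^sub>R c'" .
      then have "(s + t) *\<^sub>R q \<in> ?C"
        using c c' by (simp add: convex_cone_hull_add convex_cone_hull_mul)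
      then show ?thesis
        using pos convex_cone_hull_mul[of "(s + t) *\<^sub>R q" Y "1 / (s + t)"] by simp
    qed
  qed
  show ?thesis
    using sub cover meet by (auto simp: of_bool_def)
qed

lemma sum_Pow_insert:
  assumes "finite A" "a \<notin> A"
  shows "sum g (Pow (insert a A)) = (\<Sum>S\<in>Pow A. g S + g (insert a S))"
proof -
  have "inj_on (insert a) (Pow A)"
    using assms(2) by (intro inj_onI) (metis Pow_iff in_mono insert_ident)
  moreover have "Pow A \<inter> insert a ` Pow A = {}"
    using assms(2) by auto
  ultimately show ?thesis
    using assms(1) by (simp add: Pow_insert sum.union_disjoint sum.reindex sum.distrib)
qed

text \<open>Splitting off a vector \<open>p = f b\<close> turns the sum for \<open>X\<close> into the sum for \<open>X\<close> minus the one for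
  \<open>X \<union> {p}\<close>. By the valuation identity this is the sum for \<open>X \<union> {-p}\<close> minus the one for
  \<open>X \<union> {p, -p}\<close>. As soon as \<open>-p\<close> is adjoined to \<open>X\<close>, the term \<open>z\<^sub>b p\<close> may be dropped from the given
  relation, so both of these vanish by induction. At the end only \<open>f a \<in> cone X\<close> remains, and
  the terms \<open>S = {}\<close> and \<open>S = {a}\<close> cancel.\<close>

lemma alternating_cone_sum_eq_0:
  fixes f :: "'i \<Rightarrow> 'a::real_vector"
  assumes "finite B" "a \<notin> B" "0 < z a" "\<And>i. i \<in> B \<Longrightarrow> 0 \<le> z i"
    and "(\<Sum>i\<in>insert a B. z i *\<^sub>R f i) \<in> convex_cone hull X"
  shows "(\<Sum>S\<in>Pow (insert a B). (- 1) ^ card S * of_bool (q \<in> convex_cone hull (X \<union> f ` S)))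
         = (0::int)"
  using assms
proof (induction B arbitrary: X rule: finite_induct)
  case empty
  then have "z a *\<^sub>R f a \<in> convex_cone hull X"
    by simp
  then have "f a \<in> convex_cone hull X"
    using empty convex_cone_hull_mul[of "z a *\<^sub>R f a" X "1 / z a"] by simp
  then have "convex_cone hull (insert (f a) X) = convex_cone hull X"
    by (rule hull_redundant)
  then show ?case
    by (subst sum_Pow_insert) simp_all
next
  case (insert b B)
  let ?p = "f b"
  let ?g = "\<lambda>X. \<Sum>S\<in>Pow (insert a B).
      (- 1) ^ card S * of_bool (q \<in> convex_cone hull (X \<union> f ` S)) :: int"
  have ab: "b \<notin> insert a B" "finite (insert a B)" "a \<notin> B"
    using insert by auto
  have vanish: "?g Y = 0" if Y: "X \<subseteq> Y" "- ?p \<in> Y" for Y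
  proof (rule insert.IH)
    have "(\<Sum>i\<in>insert a B. z i *\<^sub>R f i) = (\<Sum>i\<in>insert a (insert b B). z i *\<^sub>R f i) + z b *\<^sub>R (- ?p)"
      using ab insert.hyps by (simp add: algebra_simps)
    moreover have "(\<Sum>i\<in>insert a (insert b B). z i *\<^sub>R f i) \<in> convex_cone hull Y"
      using insert.prems(4) hull_mono[OF Y(1)] by blast
    moreover have "z b *\<^sub>R (- ?p) \<in> convex_cone hull Y"
      using Y(2) insert.prems(3) by (intro convex_cone_hull_mul hull_inc) auto
    ultimately show "(\<Sum>i\<in>insert a B. z i *\<^sub>R f i) \<in> convex_cone hull Y"
      by (simp only: convex_cone_hull_add)
  qed (use insert.prems ab in auto)
  have split: "of_bool (q \<in> convex_cone hull Y) - of_bool (q \<in> convex_cone hull (insert ?p Y))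
      = (of_bool (q \<in> convex_cone hull (insert (- ?p) Y))
         - of_bool (q \<in> convex_cone hull (insert ?p (insert (- ?p) Y))) :: int)" for Y
    using cone_line_valuation[of q Y ?p] by linarith
  have card: "card (insert b S) = Suc (card S)" if "S \<in> Pow (insert a B)" for S
    using that ab by (meson PowD card_insert_disjoint finite_subset subsetD)
  have "(\<Sum>S\<in>Pow (insert b (insert a B)).
           (- 1) ^ card S * of_bool (q \<in> convex_cone hull (X \<union> f ` S)) :: int)
      = (\<Sum>S\<in>Pow (insert a B). (- 1) ^ card S * (of_bool (q \<in> convex_cone hull (X \<union> f ` S))
           - of_bool (q \<in> convex_cone hull (insert ?p (X \<union> f ` S)))))"
    unfolding sum_Pow_insert[OF ab(2,1)]
    by (rule sum.cong) (auto simp: card algebra_simps)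
  also have "\<dots> = ?g (insert (- ?p) X) - ?g (insert ?p (insert (- ?p) X))"
    unfolding sum_subtractf[symmetric] right_diff_distrib[symmetric] Un_insert_left
    by (intro sum.cong refl arg_cong2[where f = "(*)"] split)
  also have "?g (insert (- ?p) X) = 0"
    by (rule vanish) auto
  also have "?g (insert ?p (insert (- ?p) X)) = 0"
    by (rule vanish) auto
  finally show ?case
    by (simp only: insert_commute diff_self)
qed

section \<open>Topes and the cones of subfamilies\<close>

lemma gen_cone_eq_hull:
  assumes "finite I"
  shows "gen_cone \<Phi> I = convex_cone hull (\<Phi> ` I)"
proof
  show "gen_cone \<Phi> I \<subseteq> convex_cone hull (\<Phi> ` I)"
  proof
    fix x assume "x \<in> gen_cone \<Phi> I"
    then obtain t where t: "x = (\<Sum>i\<in>I. t i *\<^sub>R \<Phi> i)" "\<And>i. i \<in> I \<Longrightarrow> 0 \<le> t i"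
      by (auto simp: gen_cone_def)
    have "(\<Sum>i\<in>J. t i *\<^sub>R \<Phi> i) \<in> convex_cone hull (\<Phi> ` I)" if "J \<subseteq> I" for J
      using finite_subset[OF that assms] that
    proof (induction J rule: finite_induct)
      case empty
      show ?case by (simp add: convex_cone_hull_contains_0)
    next
      case (insert j J)
      then have "\<Phi> j \<in> convex_cone hull (\<Phi> ` I)"
        by (intro hull_inc) auto
      then have "t j *\<^sub>R \<Phi> j \<in> convex_cone hull (\<Phi> ` I)"
        using insert t(2) by (intro convex_cone_hull_mul) auto
      then show ?case
        using insert by (simp add: convex_cone_hull_add)
    qed
    then show "x \<in> convex_cone hull (\<Phi> ` I)"
      using t(1) by blast
  qed
  show "convex_cone hull (\<Phi> ` I) \<subseteq> gen_cone \<Phi> I"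
  proof (rule hull_minimal)
    show "\<Phi> ` I \<subseteq> gen_cone \<Phi> I"
    proof
      fix x assume "x \<in> \<Phi> ` I"
      then obtain j where j: "j \<in> I" "x = \<Phi> j" by blast
      have "(\<Sum>i\<in>I. of_bool (i = j) *\<^sub>R \<Phi> i) = (\<Sum>i\<in>I. if i = j then \<Phi> i else 0)"
        by (intro sum.cong) auto
      then have "\<Phi> j = (\<Sum>i\<in>I. of_bool (i = j) *\<^sub>R \<Phi> i)"
        using assms j(1) by simp
      then show "x \<in> gen_cone \<Phi> I"
        unfolding gen_cone_def j(2) by (intro CollectI exI[of _ "\<lambda>i. of_bool (i = j)"]) auto
    qed
    show "convex_cone (gen_cone \<Phi> I)"
      unfolding convex_cone_iff
    proof (intro conjI ballI allI impI)
      show "0 \<in> gen_cone \<Phi> I"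
        unfolding gen_cone_def by (intro CollectI exI[of _ "\<lambda>_. 0"]) auto
    next
      fix x y assume "x \<in> gen_cone \<Phi> I" "y \<in> gen_cone \<Phi> I"
      then obtain s t where "x = (\<Sum>i\<in>I. s i *\<^sub>R \<Phi> i)" "\<forall>i\<in>I. 0 \<le> s i"
          "y = (\<Sum>i\<in>I. t i *\<^sub>R \<Phi> i)" "\<forall>i\<in>I. 0 \<le> t i"
        by (auto simp: gen_cone_def)
      then show "x + y \<in> gen_cone \<Phi> I"
        unfolding gen_cone_def
        by (intro CollectI exI[of _ "\<lambda>i. s i + t i"]) (auto simp: scaleR_add_left sum.distrib)
    next
      fix x and c :: real assume "x \<in> gen_cone \<Phi> I" and c: "0 \<le> c"
      then obtain s where "x = (\<Sum>i\<in>I. s i *\<^sub>R \<Phi> i)" "\<forall>i\<in>I. 0 \<le> s i"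
        by (auto simp: gen_cone_def)
      then show "c *\<^sub>R x \<in> gen_cone \<Phi> I"
        unfolding gen_cone_def using c
        by (intro CollectI exI[of _ "\<lambda>i. c * s i"]) (auto simp: scaleR_sum_right)
    qed
  qed
qed

text \<open>A basis of the span chosen inside the subfamily extends, inside the generating family, to a
  basis of the whole space; leaving out one of the added vectors gives a wall.\<close>

lemma proper_span_subset_wall:
  fixes \<Phi> :: "'n \<Rightarrow> 'a::euclidean_space"
  assumes gen: "span (range \<Phi>) = UNIV" and proper: "span (\<Phi> ` J) \<noteq> UNIV"
  shows "span (\<Phi> ` J) \<subseteq> \<Union> (walls \<Phi>)"
proof -
  obtain B where B: "B \<subseteq> \<Phi> ` J" "independent B" "\<Phi> ` J \<subseteq> span B"
    by (rule maximal_independent_subset)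
  have spanB: "span B = span (\<Phi> ` J)"
    using B by (meson span_mono span_minimal subspace_span subset_antisym)
  have "B \<subseteq> range \<Phi>"
    using B(1) by blast
  then obtain C where C: "B \<subseteq> C" "C \<subseteq> range \<Phi>" "independent C" "range \<Phi> \<subseteq> span C"
    using maximal_independent_subset_extend[OF _ B(2)] by metis
  have "span C = UNIV"
    using C(4) gen by (metis span_minimal subspace_span top.extremum_uniqueI)
  then have card_C: "card C = DIM('a)"
    using C(3) by (metis dim_UNIV dim_eq_card_independent dim_span)
  have fin: "finite C"
    using C(3) independent_imp_finite by blast
  have "B \<noteq> C"
    using proper spanB \<open>span C = UNIV\<close> by auto
  then have "card B < DIM('a)"
    using C(1) fin card_C psubset_card_mono by (metis psubsetI)
  then obtain S where S: "B \<subseteq> S" "S \<subseteq> C" "card S = DIM('a) - 1"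
    using exists_subset_between[OF _ _ C(1) fin, of "DIM('a) - 1"] card_C
    by (metis Suc_pred' DIM_positive One_nat_def diff_le_self less_Suc_eq_le)
  have "independent S"
    using C(3) S(2) by (rule independent_mono)
  then have "span S \<in> walls \<Phi>"
    unfolding walls_def using S C by blast
  moreover have "span (\<Phi> ` J) \<subseteq> span S"
    using spanB span_mono[OF S(1)] by simp
  ultimately show ?thesis by blast
qed

text \<open>Positive coefficients on a spanning subfamily may be perturbed freely, and the linear
  combination map is open.\<close>

lemma interior_gen_cone:
  fixes \<Phi> :: "'n::finite \<Rightarrow> 'a::euclidean_space"
  assumes span: "span (\<Phi> ` J) = UNIV" and "J \<subseteq> I" and pos: "\<And>i. i \<in> J \<Longrightarrow> 0 < t i"
  shows "(\<Sum>i\<in>J. t i *\<^sub>R \<Phi> i) \<in> interior (gen_cone \<Phi> I)"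
proof -
  let ?f = "\<lambda>x::real^'n. \<Sum>i\<in>J. x $ i *\<^sub>R \<Phi> i"
  let ?U = "{x::real^'n. \<forall>i\<in>J. 0 < x $ i}"
  have lin: "linear ?f"
    by (auto intro!: linearI simp: scaleR_add_left sum.distrib scaleR_sum_right)
  have "\<Phi> ` J \<subseteq> range ?f"
  proof
    fix y assume "y \<in> \<Phi> ` J"
    then obtain j where j: "j \<in> J" "y = \<Phi> j" by blast
    have "?f (axis j 1) = (\<Sum>i\<in>J. if i = j then \<Phi> i else 0)"
      by (intro sum.cong) (auto simp: axis_def)
    also have "\<dots> = \<Phi> j"
      using j(1) by simp
    finally have "?f (axis j 1) = \<Phi> j" .
    then show "y \<in> range ?f"
      unfolding j(2) by (intro image_eqI[where x = "axis j 1"]) simp_all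
  qed
  then have "span (\<Phi> ` J) \<subseteq> range ?f"
    by (intro span_minimal linear_subspace_image[OF lin] subspace_UNIV)
  then have surj: "surj ?f"
    using span by auto
  have "?U = (\<Inter>i\<in>J. {x. 0 < x $ i})"
    by auto
  then have "open ?U"
    by (auto intro!: open_INT open_Collect_less continuous_intros)
  then have "open (?f ` ?U)"
    by (rule open_surjective_linear_image[OF _ lin surj])
  moreover have "?f ` ?U \<subseteq> gen_cone \<Phi> I"
  proof
    fix y assume "y \<in> ?f ` ?U"
    then have "y \<in> gen_cone \<Phi> J"
      by (force simp: gen_cone_def intro: less_imp_le)
    moreover have "gen_cone \<Phi> J \<subseteq> gen_cone \<Phi> I"
      using \<open>J \<subseteq> I\<close> by (simp add: gen_cone_eq_hull hull_mono image_mono)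
    ultimately show "y \<in> gen_cone \<Phi> I" by blast
  qed
  moreover have "(\<Sum>i\<in>J. t i *\<^sub>R \<Phi> i) \<in> ?f ` ?U"
    using pos by (intro image_eqI[of _ _ "\<chi> i. t i"]) auto
  ultimately show ?thesis
    by (intro interiorI)
qed

text \<open>Write a point of the cone as a combination and keep the vectors with positive coefficient. If
  they span, the point is interior; if they do not, their span lies in a wall.\<close>

lemma gen_cone_subset_interior_Un_walls:
  fixes \<Phi> :: "'n::finite \<Rightarrow> 'a::euclidean_space"
  assumes gen: "span (range \<Phi>) = UNIV"
  shows "gen_cone \<Phi> I \<subseteq> interior (gen_cone \<Phi> I) \<union> \<Union> (walls \<Phi>)"
proof
  fix x assume "x \<in> gen_cone \<Phi> I"
  then obtain t where t: "x = (\<Sum>i\<in>I. t i *\<^sub>R \<Phi> i)" "\<And>i. i \<in> I \<Longrightarrow> 0 \<le> t i"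
    by (auto simp: gen_cone_def)
  define J where "J = {i\<in>I. 0 < t i}"
  have x: "x = (\<Sum>i\<in>J. t i *\<^sub>R \<Phi> i)"
    unfolding t(1) J_def
    by (rule sum.mono_neutral_right) (use t(2) in \<open>auto simp: order_less_le\<close>)
  show "x \<in> interior (gen_cone \<Phi> I) \<union> \<Union> (walls \<Phi>)"
  proof (cases "span (\<Phi> ` J) = UNIV")
    case True
    have "x \<in> interior (gen_cone \<Phi> I)"
      unfolding x by (rule interior_gen_cone[OF True]) (auto simp: J_def)
    then show ?thesis ..
  next
    case False
    have "x \<in> span (\<Phi> ` J)"
      unfolding x by (intro span_sum span_scale span_base) auto
    then show ?thesis
      using proper_span_subset_wall[OF gen False] by blast
  qed
qed

text \<open>The tope is connected and disjoint from the walls, hence from the boundaries of the cones: it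
  cannot lie partly inside and partly outside one of them.\<close>

lemma mem_gen_sets_iff:
  fixes \<Phi> :: "'n::finite \<Rightarrow> 'a::euclidean_space"
  assumes gen: "span (range \<Phi>) = UNIV" and tope: "\<tau> \<in> topes \<Phi>" and p: "p \<in> \<tau>"
  shows "I \<in> gen_sets \<Phi> \<tau> \<longleftrightarrow> p \<in> gen_cone \<Phi> I"
proof
  assume "I \<in> gen_sets \<Phi> \<tau>"
  then show "p \<in> gen_cone \<Phi> I"
    using p by (auto simp: gen_sets_def)
next
  assume pI: "p \<in> gen_cone \<Phi> I"
  have off: "\<tau> \<inter> \<Union> (walls \<Phi>) = {}" and conn: "connected \<tau>"
    using tope in_components_subset in_components_connected unfolding topes_def by blast+
  have "\<tau> \<inter> frontier (gen_cone \<Phi> I) = {}"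
  proof -
    have "closed (gen_cone \<Phi> I)"
      by (simp add: gen_cone_eq_hull closed_convex_cone_hull)
    then have "frontier (gen_cone \<Phi> I) \<subseteq> \<Union> (walls \<Phi>)"
      using gen_cone_subset_interior_Un_walls[OF gen, of I] by (auto simp: frontier_def)
    with off show ?thesis by blast
  qed
  then have sub: "\<tau> \<subseteq> gen_cone \<Phi> I"
    using connected_Int_frontier[OF conn, of "gen_cone \<Phi> I"] p pI by blast
  have "p \<in> span (\<Phi> ` I)"
    using pI by (auto simp: gen_cone_def intro!: span_sum intro: span_scale span_base)
  then have "span (\<Phi> ` I) = UNIV"
    using proper_span_subset_wall[OF gen, of I] off p by blast
  with sub show "I \<in> gen_sets \<Phi> \<tau>"
    by (simp add: gen_sets_def)
qed

section \<open>Coefficients of the orthants\<close>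

definition orthant_coeff :: "('n::finite \<Rightarrow> 'a::euclidean_space) \<Rightarrow> 'a set \<Rightarrow> 'n set \<Rightarrow> int" where
  "orthant_coeff \<Phi> \<tau> N = (\<Sum>I\<in>gen_sets \<Phi> \<tau>. (- 1) ^ (card I - DIM('a)) * of_bool (N \<subseteq> I))"

lemma geom_fun_eq_orthant_coeff: "geom_fun \<Phi> \<tau> x = orthant_coeff \<Phi> \<tau> {j. x $ j < 0}"
proof -
  have "(\<Prod>j\<in>- I. indicator {y. 0 \<le> y $ j} x) = (of_bool ({j. x $ j < 0} \<subseteq> I) :: int)" for I
  proof (cases "{j. x $ j < 0} \<subseteq> I")
    case True
    then have "0 \<le> x $ j" if "j \<in> - I" for j
      using that by (meson ComplD mem_Collect_eq not_le subsetD)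
    with True show ?thesis
      by (simp add: prod.neutral)
  next
    case False
    then obtain j where "j \<in> - I" "x $ j < 0" by auto
    then show ?thesis
      using False by (auto intro!: prod_zero bexI[of _ j] simp: indicator_def)
  qed
  then show ?thesis
    by (simp add: geom_fun_def orthant_coeff_def)
qed

text \<open>Testing a single point \<open>p\<close> of the tope makes the coefficient a sum over all \<open>I \<supseteq> N\<close>, that is over
  the sets \<open>I = N \<union> S\<close>. A spanning \<open>I\<close> has at least \<open>DIM('a)\<close> elements, so the
  exponent of its sign is a true difference and the sign splits as a product.\<close>

lemma orthant_coeff_eq_cone_sum:
  fixes \<Phi> :: "'n::finite \<Rightarrow> 'a::euclidean_space"
  assumes gen: "span (range \<Phi>) = UNIV" and tope: "\<tau> \<in> topes \<Phi>" and p: "p \<in> \<tau>"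
  shows "orthant_coeff \<Phi> \<tau> N = (- 1) ^ (DIM('a) + card N) *
    (\<Sum>S\<in>Pow (- N). (- 1) ^ card S * of_bool (p \<in> convex_cone hull (\<Phi> ` N \<union> \<Phi> ` S)))"
proof -
  have sgn: "(- 1) ^ (card I - DIM('a)) = ((- 1) ^ DIM('a) * (- 1) ^ card I :: int)"
    if "I \<in> gen_sets \<Phi> \<tau>" for I
  proof -
    have "DIM('a) \<le> card (\<Phi> ` I)"
      using that dim_le_card'[of "\<Phi> ` I"]
      by (metis (mono_tags) dim_UNIV dim_span finite finite_imageI gen_sets_def mem_Collect_eq)
    also have "\<dots> \<le> card I"
      by (simp add: card_image_le)
    finally show ?thesis
      by (metis le_add_diff_inverse2 left_minus_one_mult_self mult.commute power_add)
  qed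
  have "orthant_coeff \<Phi> \<tau> N
      = (\<Sum>I\<in>gen_sets \<Phi> \<tau>. (- 1) ^ DIM('a) * (- 1) ^ card I * of_bool (N \<subseteq> I))"
    unfolding orthant_coeff_def by (rule sum.cong) (simp_all add: sgn)
  also have "\<dots> = (\<Sum>I | N \<subseteq> I.
      (- 1) ^ DIM('a) * (- 1) ^ card I * of_bool (p \<in> gen_cone \<Phi> I))"
    by (rule sum.mono_neutral_cong) (auto simp: mem_gen_sets_iff[OF gen tope p])
  also have "\<dots> = (\<Sum>S\<in>Pow (- N).
      (- 1) ^ DIM('a) * (- 1) ^ (card N + card S) * of_bool (p \<in> gen_cone \<Phi> (N \<union> S)))"
  proof (rule sum.reindex_bij_witness[of _ "\<lambda>S. N \<union> S" "\<lambda>I. I - N"])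
    fix I assume "I \<in> {I. N \<subseteq> I}"
    then have I: "N \<union> (I - N) = I" "N \<inter> (I - N) = {}" by auto
    then have "card I = card N + card (I - N)"
      using card_Un_disjoint[of N "I - N"] by simp
    with I show "(- 1) ^ DIM('a) * (- 1) ^ (card N + card (I - N))
          * of_bool (p \<in> gen_cone \<Phi> (N \<union> (I - N)))
        = ((- 1) ^ DIM('a) * (- 1) ^ card I * of_bool (p \<in> gen_cone \<Phi> I) :: int)"
      by simp
  qed auto
  also have "\<dots> = (- 1) ^ (DIM('a) + card N) *
    (\<Sum>S\<in>Pow (- N). (- 1) ^ card S * of_bool (p \<in> convex_cone hull (\<Phi> ` N \<union> \<Phi> ` S)))"
    unfolding sum_distrib_left
    by (rule sum.cong) (simp_all add: gen_cone_eq_hull image_Un power_add mult.assoc)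
  finally show ?thesis .
qed

text \<open>If \<open>z\<^sub>j\<close> were positive, then \<open>-\<Phi>\<^sub>j\<close> would be a nonnegative combination of the other vectors,
  and the cone would contain the line through \<open>0\<close> and \<open>\<Phi>\<^sub>j\<close>.\<close>

lemma salient_no_nonneg_relation:
  fixes \<Phi> :: "'n::finite \<Rightarrow> 'a::euclidean_space"
  assumes nonzero: "\<And>i. \<Phi> i \<noteq> 0" and salient: "salient (gen_cone \<Phi> UNIV)"
    and nonneg: "\<And>i. 0 \<le> z i" and rel: "(\<Sum>i\<in>UNIV. z i *\<^sub>R \<Phi> i) = 0"
  shows "z j = 0"
proof (rule ccontr)
  assume "z j \<noteq> 0"
  then have zj: "0 < z j"
    using nonneg[of j] by simp
  let ?C = "gen_cone \<Phi> UNIV"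
  have hull: "?C = convex_cone hull (range \<Phi>)"
    by (simp add: gen_cone_eq_hull)
  have plus: "\<Phi> j \<in> ?C"
    unfolding hull by (intro hull_inc) simp
  have "(\<Sum>i\<in>- {j}. z i *\<^sub>R \<Phi> i) = - (z j *\<^sub>R \<Phi> j)"
    using rel sum.remove[of UNIV j "\<lambda>i. z i *\<^sub>R \<Phi> i"]
    by (simp add: Compl_eq_Diff_UNIV eq_neg_iff_add_eq_0 add.commute)
  then have "- (z j *\<^sub>R \<Phi> j) \<in> gen_cone \<Phi> (- {j})"
    using nonneg unfolding gen_cone_def by (intro CollectI exI[of _ z]) auto
  then have "- (z j *\<^sub>R \<Phi> j) \<in> ?C"
    using hull_mono[of "\<Phi> ` (- {j})" "range \<Phi>" convex_cone] by (auto simp: gen_cone_eq_hull)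
  then have "(1 / z j) *\<^sub>R (- (z j *\<^sub>R \<Phi> j)) \<in> ?C"
    unfolding hull using zj by (intro convex_cone_hull_mul) auto
  then have minus: "- \<Phi> j \<in> ?C"
    using zj by simp
  have "span {\<Phi> j} \<subseteq> ?C"
  proof
    fix y assume "y \<in> span {\<Phi> j}"
    then obtain c where y: "y = c *\<^sub>R \<Phi> j"
      by (auto simp: span_singleton)
    show "y \<in> ?C"
    proof (cases "0 \<le> c")
      case True
      with plus show ?thesis
        unfolding y hull by (rule convex_cone_hull_mul)
    next
      case False
      then have "(- c) *\<^sub>R (- \<Phi> j) \<in> ?C"
        using minus unfolding hull by (intro convex_cone_hull_mul) auto
      then show ?thesis
        by (simp add: y)
    qed
  qed
  moreover have "affine (span {\<Phi> j})"
    by (simp add: subspace_imp_affine)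
  moreover have "aff_dim (span {\<Phi> j}) = 1"
    using nonzero[of j] by (simp add: aff_dim_subspace dim_eq_card_independent)
  ultimately show False
    using salient unfolding salient_def by blast
qed

text \<open>Moving the terms of the relation with index in \<open>N\<close> to the other side puts a nonnegative
  combination of the remaining vectors into the cone of \<open>N\<close>, which is the hypothesis under which the
  alternating cone sum vanishes. Salience supplies the strictly positive coefficient needed there.\<close>

lemma orthant_coeff_eq_0:
  fixes \<Phi> :: "'n::finite \<Rightarrow> 'a::euclidean_space"
  assumes nonzero: "\<And>i. \<Phi> i \<noteq> 0"
    and gen: "span (range \<Phi>) = UNIV"
    and salient: "salient (gen_cone \<Phi> UNIV)"
    and tope: "\<tau> \<in> topes \<Phi>"
    and rel: "(\<Sum>i\<in>UNIV. z i *\<^sub>R \<Phi> i) = 0" and "z k \<noteq> 0"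
    and neg: "\<And>i. i \<in> N \<Longrightarrow> z i \<le> 0" and nonneg: "\<And>i. i \<notin> N \<Longrightarrow> 0 \<le> z i"
  shows "orthant_coeff \<Phi> \<tau> N = 0"
proof -
  obtain p where p: "p \<in> \<tau>"
    using tope in_components_nonempty unfolding topes_def by blast
  \<comment> \<open>Otherwise \<open>- z\<close> would be a nonzero nonnegative relation.\<close>
  have "\<exists>a. a \<notin> N \<and> 0 < z a"
  proof (rule ccontr)
    assume "\<nexists>a. a \<notin> N \<and> 0 < z a"
    then have "0 \<le> - z i" for i
      using neg[of i] by force
    moreover have "(\<Sum>i\<in>UNIV. (- z i) *\<^sub>R \<Phi> i) = 0"
      using rel by (simp add: sum_negf)
    ultimately have "- z k = 0"
      using salient_no_nonneg_relation[OF nonzero salient, of "\<lambda>i. - z i"] by blast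
    with \<open>z k \<noteq> 0\<close> show False by simp
  qed
  then obtain a where a: "a \<notin> N" "0 < z a" by blast
  define B where "B = - N - {a}"
  have B: "insert a B = - N"
    using a(1) by (auto simp: B_def)
  have "(\<Sum>i\<in>- N. z i *\<^sub>R \<Phi> i) = (\<Sum>i\<in>N. (- z i) *\<^sub>R \<Phi> i)"
    using rel sum.subset_diff[of N UNIV "\<lambda>i. z i *\<^sub>R \<Phi> i"]
    by (simp add: Compl_eq_Diff_UNIV sum_negf eq_neg_iff_add_eq_0)
  moreover have "(\<Sum>i\<in>N. (- z i) *\<^sub>R \<Phi> i) \<in> gen_cone \<Phi> N"
    unfolding gen_cone_def using neg by (intro CollectI exI[of _ "\<lambda>i. - z i"]) auto
  ultimately have "(\<Sum>i\<in>insert a B. z i *\<^sub>R \<Phi> i) \<in> convex_cone hull (\<Phi> ` N)"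
    by (simp add: B gen_cone_eq_hull)
  then have "(\<Sum>S\<in>Pow (insert a B).
      (- 1) ^ card S * of_bool (p \<in> convex_cone hull (\<Phi> ` N \<union> \<Phi> ` S))) = (0::int)"
    using a nonneg by (intro alternating_cone_sum_eq_0[of B a z]) (auto simp: B_def)
  then show ?thesis
    using orthant_coeff_eq_cone_sum[OF gen tope p, of N] by (simp add: B)
qed

section \<open>The pieces of a fibre\<close>

definition fibre_piece :: "('n::finite \<Rightarrow> 'a::real_vector) \<Rightarrow> 'a \<Rightarrow> 'n set \<Rightarrow> (real ^ 'n) set" where
  "fibre_piece \<Phi> v N = {x \<in> part_space \<Phi> v. {j. x $ j < 0} = N}"

text \<open>When no nonzero vector of the closed orthant is a relation, the norm of \<open>\<Sum>\<^sub>i x\<^sub>i \<Phi>\<^sub>i\<close> has a positive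
  minimum \<open>m\<close> on the unit vectors of the orthant. By homogeneity \<open>m \<bar>x\<bar> \<le> \<bar>v\<bar>\<close> on the piece.\<close>

lemma bounded_fibre_piece:
  fixes \<Phi> :: "'n::finite \<Rightarrow> 'a::euclidean_space"
  assumes no_rel: "\<And>z. \<lbrakk>(\<Sum>i\<in>UNIV. z $ i *\<^sub>R \<Phi> i) = 0; \<forall>i\<in>N. z $ i \<le> 0; \<forall>i\<in>- N. 0 \<le> z $ i\<rbrakk>
      \<Longrightarrow> z = 0"
  shows "bounded (fibre_piece \<Phi> v N)"
proof -
  let ?f = "\<lambda>x::real^'n. \<Sum>i\<in>UNIV. x $ i *\<^sub>R \<Phi> i"
  define Q where "Q = {x::real^'n. (\<forall>i\<in>N. x $ i \<le> 0) \<and> (\<forall>i\<in>- N. 0 \<le> x $ i)}"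
  have "Q = (\<Inter>i\<in>N. {x. x $ i \<le> 0}) \<inter> (\<Inter>i\<in>- N. {x. 0 \<le> x $ i})"
    by (auto simp: Q_def)
  then have "closed Q"
    by (auto intro!: closed_Int closed_INT closed_Collect_le continuous_intros)
  then have compact: "compact (sphere 0 1 \<inter> Q)"
    by (intro compact_Int_closed compact_sphere)
  have "\<exists>m>0. \<forall>y\<in>sphere 0 1 \<inter> Q. m \<le> norm (?f y)"
  proof (cases "sphere 0 1 \<inter> Q = {}")
    case True
    then show ?thesis
      by (metis empty_iff zero_less_one)
  next
    case False
    have "continuous_on (sphere 0 1 \<inter> Q) (\<lambda>x. norm (?f x))"
      by (intro continuous_intros)
    then obtain y where y: "y \<in> sphere 0 1 \<inter> Q" "\<And>x. x \<in> sphere 0 1 \<inter> Q \<Longrightarrow> norm (?f y) \<le> norm (?f x)"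
      using continuous_attains_inf[OF compact False] by blast
    have "?f y \<noteq> 0"
      using y(1) no_rel[of y] by (auto simp: Q_def)
    with y(2) show ?thesis
      by (intro exI[of _ "norm (?f y)"]) auto
  qed
  then obtain m where m: "0 < m" "\<And>y. y \<in> sphere 0 1 \<inter> Q \<Longrightarrow> m \<le> norm (?f y)"
    by blast
  have "norm x \<le> norm v / m" if x: "x \<in> fibre_piece \<Phi> v N" for x
  proof (cases "x = 0")
    case True
    with m(1) show ?thesis by simp
  next
    case False
    let ?y = "(1 / norm x) *\<^sub>R x"
    have xQ: "\<forall>i\<in>N. x $ i \<le> 0" "\<forall>i\<in>- N. 0 \<le> x $ i" "?f x = v"
      using x by (auto simp: fibre_piece_def part_space_def)
    have "?y \<in> sphere 0 1 \<inter> Q"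
      using False xQ by (auto simp: Q_def divide_nonpos_nonneg)
    then have "m \<le> norm (?f ?y)"
      by (rule m(2))
    also have "?f ?y = (1 / norm x) *\<^sub>R ?f x"
      unfolding scaleR_sum_right by (intro sum.cong) simp_all
    also have "?f x = v"
      by (rule xQ(3))
    finally show ?thesis
      using False m(1) by (simp add: field_simps)
  qed
  then show ?thesis
    by (rule boundedI)
qed

lemma semi_open_polytope_fibre_piece:
  fixes \<Phi> :: "'n::finite \<Rightarrow> 'a::euclidean_space"
  assumes "bounded (fibre_piece \<Phi> v N)"
  shows "semi_open_polytope (fibre_piece \<Phi> v N)"
proof -
  define E :: "((real^'n) \<times> real) set" where "E = (\<lambda>b. (\<chi> i. \<Phi> i \<bullet> b, v \<bullet> b)) ` Basis"
  define W :: "((real^'n) \<times> real) set" where "W = (\<lambda>j. (- axis j 1, 0)) ` (- N)"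
  define S :: "((real^'n) \<times> real) set" where "S = (\<lambda>j. (axis j 1, 0)) ` N"
  have E: "(\<forall>(a, b)\<in>E. a \<bullet> x = b) \<longleftrightarrow> x \<in> part_space \<Phi> v" for x
  proof -
    have "(\<chi> i. \<Phi> i \<bullet> b) \<bullet> x = (\<Sum>i\<in>UNIV. x $ i *\<^sub>R \<Phi> i) \<bullet> b" for b
      by (simp add: inner_vec_def inner_sum_left mult.commute)
    then show ?thesis
      by (simp add: E_def part_space_def euclidean_eq_iff[of "\<Sum>i\<in>UNIV. x $ i *\<^sub>R \<Phi> i"])
  qed
  have W: "(\<forall>(a, b)\<in>W. a \<bullet> x \<le> b) \<longleftrightarrow> (\<forall>j\<in>- N. 0 \<le> x $ j)" for x
    by (simp add: W_def inner_axis')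
  have S: "(\<forall>(a, b)\<in>S. a \<bullet> x < b) \<longleftrightarrow> (\<forall>j\<in>N. x $ j < 0)" for x
    by (simp add: S_def inner_axis')
  have piece: "{j. x $ j < 0} = N \<longleftrightarrow> (\<forall>j\<in>- N. 0 \<le> x $ j) \<and> (\<forall>j\<in>N. x $ j < 0)"
    for x :: "real^'n"
    unfolding set_eq_iff mem_Collect_eq Ball_def Compl_iff by (metis not_le)
  have "finite E" "finite W" "finite S"
    by (simp_all add: E_def W_def S_def)
  moreover have "fibre_piece \<Phi> v N = {x. (\<forall>(a, b)\<in>E. a \<bullet> x = b) \<and> (\<forall>(a, b)\<in>W. a \<bullet> x \<le> b)
      \<and> (\<forall>(a, b)\<in>S. a \<bullet> x < b)}"
    unfolding E W S fibre_piece_def piece by blast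
  ultimately show ?thesis
    using assms unfolding semi_open_polytope_def by blast
qed

section \<open>Signed sums of polytopes\<close>

text \<open>Different indices may give the same polytope, whose coefficient is then the sum of theirs.\<close>

lemma signed_sum_of_polytopes_indexed:
  assumes fin: "finite A" and poly: "\<And>i. i \<in> A \<Longrightarrow> semi_open_polytope (P i)"
  shows "signed_sum_of_polytopes (\<lambda>x. \<Sum>i\<in>A. c i * indicator (P i) x)"
proof -
  have "(\<Sum>i\<in>A. c i * indicator (P i) x)
      = (\<Sum>R\<in>P ` A. (\<Sum>i | i \<in> A \<and> P i = R. c i) * indicator R x)" for x
    unfolding sum.image_gen[OF fin, of _ P] sum_distrib_right by (intro sum.cong) auto
  then show ?thesis
    unfolding signed_sum_of_polytopes_def using fin poly
    by (intro exI[of _ "P ` A"] exI[of _ "\<lambda>R. \<Sum>i | i \<in> A \<and> P i = R. c i"]) auto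
qed

lemma bounded_support_signed_sum_of_polytopes:
  assumes "signed_sum_of_polytopes f"
  shows "bounded (support_on UNIV f)"
proof -
  obtain \<P> c where P: "finite \<P>" "\<forall>P\<in>\<P>. semi_open_polytope P"
      and f: "f = (\<lambda>x. \<Sum>P\<in>\<P>. c P * indicator P x)"
    using assms unfolding signed_sum_of_polytopes_def by blast
  have "f x = 0" if "x \<notin> \<Union> \<P>" for x
    unfolding f using that by (intro sum.neutral) auto
  then have "support_on UNIV f \<subseteq> \<Union> \<P>"
    by (auto simp: support_on_def)
  moreover have "bounded (\<Union> \<P>)"
    using P by (intro bounded_Union) (auto simp: semi_open_polytope_def)
  ultimately show ?thesis
    using bounded_subset by blast
qed

theorem corollary29:
  fixes \<Phi> :: "'n::finite \<Rightarrow> 'a::euclidean_space"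
    and \<tau> :: "'a set"
    and v :: 'a
  assumes nonzero: "\<And>i. \<Phi> i \<noteq> 0"
    and generates: "span (range \<Phi>) = UNIV"
    and salient: "salient (gen_cone \<Phi> UNIV)"
    and tope: "\<tau> \<in> topes \<Phi>"
  shows "signed_sum_of_polytopes (\<lambda>x. geom_fun \<Phi> \<tau> x * indicator (part_space \<Phi> v) x)
    \<and> bounded (support_on UNIV (\<lambda>x. geom_fun \<Phi> \<tau> x * indicator (part_space \<Phi> v) x))"
proof -
  let ?f = "\<lambda>x. geom_fun \<Phi> \<tau> x * indicator (part_space \<Phi> v) x"
  define A where "A = {N. orthant_coeff \<Phi> \<tau> N \<noteq> 0}"
  have poly: "semi_open_polytope (fibre_piece \<Phi> v N)" if "N \<in> A" for N
  proof (intro semi_open_polytope_fibre_piece bounded_fibre_piece)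
    fix z :: "real^'n"
    assume z: "(\<Sum>i\<in>UNIV. z $ i *\<^sub>R \<Phi> i) = 0" "\<forall>i\<in>N. z $ i \<le> 0" "\<forall>i\<in>- N. 0 \<le> z $ i"
    have "z $ k = 0" for k
    proof (rule ccontr)
      assume "z $ k \<noteq> 0"
      then have "orthant_coeff \<Phi> \<tau> N = 0"
        using orthant_coeff_eq_0[OF nonzero generates salient tope z(1), of k N] z(2,3) by simp
      with that show False
        by (simp add: A_def)
    qed
    then show "z = 0"
      by (simp add: vec_eq_iff)
  qed
  have "?f = (\<lambda>x. \<Sum>N\<in>A. orthant_coeff \<Phi> \<tau> N * indicator (fibre_piece \<Phi> v N) x)"
  proof
    fix x :: "real^'n"
    let ?N = "{j. x $ j < 0}"
    have "(\<Sum>N\<in>A. orthant_coeff \<Phi> \<tau> N * indicator (fibre_piece \<Phi> v N) x)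
        = (\<Sum>N\<in>UNIV. orthant_coeff \<Phi> \<tau> N * indicator (fibre_piece \<Phi> v N) x)"
      by (rule sum.mono_neutral_left) (auto simp: A_def)
    also have "\<dots> = (\<Sum>N\<in>{?N}. orthant_coeff \<Phi> \<tau> N * indicator (fibre_piece \<Phi> v N) x)"
      by (rule sum.mono_neutral_right) (auto simp: fibre_piece_def)
    also have "\<dots> = ?f x"
      by (simp add: geom_fun_eq_orthant_coeff fibre_piece_def indicator_def)
    finally show "?f x = (\<Sum>N\<in>A. orthant_coeff \<Phi> \<tau> N * indicator (fibre_piece \<Phi> v N) x)"
      by simp
  qed
  then have "signed_sum_of_polytopes ?f"
    using signed_sum_of_polytopes_indexed[of A "fibre_piece \<Phi> v"] poly by simp
  then show ?thesis
    using bounded_support_signed_sum_of_polytopes by blast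
qed

end
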